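(* Consider the mobility-on-demand fluid model described in the context. Let $(\alpha,\beta)\in\mathcal A\times\mathcal B$ be a feasible assignment, and assume $V>V_\alpha$ and $R>R_{\alpha,\beta}$. Then the set of equilibria $$\mathcal E_{\alpha,\beta}=\Bigl\{(\mathbf c,\mathbf v,\mathbf r)\in\mathbb R^{3n}\,\Big|\,c_i=0,\ v_i>0,\ r_i>0\ \text{for all } i\in\mathcal N,\ \sum_iv_i=V-V_\alpha,\ \sum_ir_i=R-R_{\alpha,\beta}\Bigr\}$$ is locally asymptotically stable (in the sense defined in the context).
   Context: Parameters: $n$ stations, $\mathcal N=\{1,\dots,n\}$; customer arrival rates $\lambda_i>0$; departure rates $\mu_i>\lambda_i$; destination fractions $p_{ij}\ge 0$ with $p_{ii}=0$ and $\sum_jp_{ij}=1$; travel times $T_{ij}\ge 0$; taxi-willingness fractions $f_{ij}\in(0,1]$; total number of vehicles $V>0$ and of drivers $R>0$. Put $D_i=-\lambda_i+\sum_{j\ne i}\lambda_jp_{ji}$; standing assumption: $D_i\ne0$ for all $i$. Assignments: $\mathcal A\times\mathcal B$ is the set of pairs $(\alpha,\beta)$ of $n\times n$ matrices with zero diagonals satisfying $\sum_{j\ne i}(\alpha_{ij}-\alpha_{ji})=D_i$ and $\sum_{j\ne i}(\beta_{ij}-\beta_{ji})=-D_i$ for each $i$. It is feasible if also $\alpha_{ij}\ge0$ and $0\le\beta_{ij}\le f_{ij}\lambda_ip_{ij}$ for all $i,j$. Put $\gamma_i=\sum_j\alpha_{ij}$, $V_\alpha=\sum_{i,j}T_{ij}(p_{ij}\lambda_i+\alpha_{ij})$,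 $R_{\alpha,\beta}=\sum_{i,j}T_{ij}(\alpha_{ij}+\beta_{ij})$. Model: $c_i(t),v_i(t),r_i(t)$ are the (real) numbers of customers, idle vehicles, and idle drivers at station $i$. Let $H(x)=1$ if $x>0$ and $H(x)=0$ otherwise; unsuperscripted quantities are evaluated at time $t$, and $c_j^i=c_j(t-T_{ji})$, $v_j^i=v_j(t-T_{ji})$, $r_j^i=r_j(t-T_{ji})$. For $t\ge0$, $$\dot c_i=\lambda_i(1-H(v_i))+(\lambda_i-\mu_i)H(c_i)H(v_i),$$ $$\dot v_i=-\lambda_iH(v_i)+(\lambda_i-\mu_i)H(c_i)H(v_i)+\sum_{j\ne i}p_{ji}\bigl(\lambda_jH(v_j^i)-(\lambda_j-\mu_j)H(c_j^i)H(v_j^i)\bigr)-\gamma_iH(v_i)H(r_i)+\sum_{j\ne i}\alpha_{ji}H(v_j^i)H(r_j^i),$$ $$\dot r_i=-\gamma_iH(v_i)H(r_i)+\sum_{j\ne i}\alpha_{ji}H(v_j^i)H(r_j^i)-\sum_{j\ne i}\beta_{ij}H(v_i)H(r_i)+\sum_{j\ne i}\beta_{ji}H(v_j^i)H(r_j^i).$$ Evolutions (solutions in the Filippov sense): for each station $i$ let $G(c,v,r)=(H(v),H(c)H(v),H(v)H(r))$ on $\mathbb R^3$ and let $K[G](x)=\bigcap_{\delta>0}\bigcap_{N\text{ null}}\overline{\mathrm{co}}\,G(B_\delta(x)\setminus N)$ be its Filippov regularization. An evolution is a family of functions on $[-\max_{i,j}T_{ij},\infty)$ with the prescribed initial data,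 locally absolutely continuous on $[0,\infty)$, for which there are measurable selections $g_i(t)\in K[G](c_i(t),v_i(t),r_i(t))$, $t\ge 0$ (and $g_i(t)=G(c_i(t),v_i(t),r_i(t))$ for $t<0$), such that the equations hold for a.e. $t\ge 0$ when $(H(v_i),H(c_i)H(v_i),H(v_i)H(r_i))$ at time $t$ is replaced by $g_i(t)$ and the delayed terms $(H(v_j^i),H(c_j^i)H(v_j^i),H(v_j^i)H(r_j^i))$ are replaced by $g_j(t-T_{ji})$. Local asymptotic stability: $\mathcal E_{\alpha,\beta}$ is locally asymptotically stable if for every $(\underline{\mathbf c},\underline{\mathbf v},\underline{\mathbf r})\in\mathcal E_{\alpha,\beta}$ there is $\delta>0$ such that, with $$\mathcal B^\delta_{\alpha,\beta}(\underline{\mathbf c},\underline{\mathbf v},\underline{\mathbf r})=\Bigl\{(\mathbf c,\mathbf v,\mathbf r)\in\mathbb R^{3n}:\ c_i,v_i,r_i\ge0\ \forall i,\ \|(\mathbf c-\underline{\mathbf c},\mathbf v-\underline{\mathbf v},\mathbf r-\underline{\mathbf r})\|<\delta,\ \sum_iv_i=V-V_\alpha,\ \sum_ir_i=R-R_{\alpha,\beta}\Bigr\},$$ every evolution of the model with $c_i(\tau)=\underline c_i$, $v_i(\tau)=\underline v_i$, $r_i(\tau)=\underline r_i$ for $\tau\in[-\max_{i,j}T_{ij},0)$ and all $i$, and $(\mathbf c(0),\mathbf v(0),\mathbf r(0))\in\mathcal B^\delta_{\alpha,\beta}(\underline{\mathbf c},\underline{\mathbf v},\underline{\mathbf r})$,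 has a limit belonging to the equilibrium set: $\bigl(\lim_{t\to+\infty}\mathbf c(t),\lim_{t\to+\infty}\mathbf v(t),\lim_{t\to+\infty}\mathbf r(t)\bigr)\in\mathcal E_{\alpha,\beta}$. *)

theory Defs
  imports "HOL-Analysis.Analysis"
begin

text \<open>
  Stations are the elements of a finite type \<open>'n\<close>. A quantity indexed by a pair of stations is a
  matrix, read as \<open>p $ i $ j\<close> for $p_{ij}$.
\<close>

subsection \<open>Absolute continuity and Filippov regularization\<close>

definition absolutely_continuous_on :: "real set \<Rightarrow> (real \<Rightarrow> 'a::metric_space) \<Rightarrow> bool" where
  "absolutely_continuous_on S u \<longleftrightarrow>
     (\<forall>\<epsilon>>0. \<exists>\<delta>>0. \<forall>I :: (real \<times> real) set.
        finite I \<and> (\<forall>(a, b)\<in>I. a < b \<and> {a..b} \<subseteq> S) \<and>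
        pairwise (\<lambda>(a, b) (a', b'). {a<..<b} \<inter> {a'<..<b'} = {}) I \<and>
        (\<Sum>(a, b)\<in>I. b - a) < \<delta>
        \<longrightarrow> (\<Sum>(a, b)\<in>I. dist (u a) (u b)) < \<epsilon>)"

definition locally_absolutely_continuous_nonneg :: "(real \<Rightarrow> 'a::metric_space) \<Rightarrow> bool" where
  "locally_absolutely_continuous_nonneg u \<longleftrightarrow> (\<forall>b\<ge>0. absolutely_continuous_on {0..b} u)"

definition filippov :: "('a::euclidean_space \<Rightarrow> 'b::real_normed_vector) \<Rightarrow> 'a \<Rightarrow> 'b set" where
  "filippov F x =
     (\<Inter>\<delta>\<in>{0<..}. \<Inter>N\<in>null_sets lebesgue. closure (convex hull (F ` (ball x \<delta> - N))))"


subsection \<open>Assignments\<close>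

definition demand_imbalance :: "real^'n \<Rightarrow> real^'n^'n \<Rightarrow> 'n \<Rightarrow> real" where
  "demand_imbalance lam p i = - lam $ i + (\<Sum>j\<in>UNIV - {i}. lam $ j * p $ j $ i)"

definition assignment ::
    "real^'n \<Rightarrow> real^'n^'n \<Rightarrow> real^'n^'n \<Rightarrow> real^'n^'n \<Rightarrow> bool" where
  "assignment lam p \<alpha> \<beta> \<longleftrightarrow>
     (\<forall>i. \<alpha> $ i $ i = 0) \<and> (\<forall>i. \<beta> $ i $ i = 0) \<and>
     (\<forall>i. (\<Sum>j\<in>UNIV - {i}. \<alpha> $ i $ j - \<alpha> $ j $ i) = demand_imbalance lam p i) \<and>
     (\<forall>i. (\<Sum>j\<in>UNIV - {i}. \<beta> $ i $ j - \<beta> $ j $ i) = - demand_imbalance lam p i)"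

definition feasible_assignment ::
    "real^'n \<Rightarrow> real^'n^'n \<Rightarrow> real^'n^'n \<Rightarrow> real^'n^'n \<Rightarrow> real^'n^'n \<Rightarrow> bool" where
  "feasible_assignment lam p f \<alpha> \<beta> \<longleftrightarrow>
     assignment lam p \<alpha> \<beta> \<and>
     (\<forall>i j. 0 \<le> \<alpha> $ i $ j) \<and>
     (\<forall>i j. 0 \<le> \<beta> $ i $ j \<and> \<beta> $ i $ j \<le> f $ i $ j * lam $ i * p $ i $ j)"

definition rebalancing_rate :: "real^'n^'n \<Rightarrow> 'n \<Rightarrow> real" where
  "rebalancing_rate \<alpha> i = (\<Sum>j\<in>UNIV. \<alpha> $ i $ j)"

definition V_required ::
    "real^'n \<Rightarrow> real^'n^'n \<Rightarrow> real^'n^'n \<Rightarrow> real^'n^'n \<Rightarrow> real" where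
  "V_required lam p T \<alpha> =
     (\<Sum>i\<in>UNIV. \<Sum>j\<in>UNIV. T $ i $ j * (p $ i $ j * lam $ i + \<alpha> $ i $ j))"

definition R_required :: "real^'n^'n \<Rightarrow> real^'n^'n \<Rightarrow> real^'n^'n \<Rightarrow> real" where
  "R_required T \<alpha> \<beta> = (\<Sum>i\<in>UNIV. \<Sum>j\<in>UNIV. T $ i $ j * (\<alpha> $ i $ j + \<beta> $ i $ j))"

definition max_travel_time :: "real^'n^'n \<Rightarrow> real" where
  "max_travel_time T = Max (range (\<lambda>(i, j). T $ i $ j))"


subsection \<open>The model\<close>

definition heaviside :: "real \<Rightarrow> real" where
  "heaviside x = (if x > 0 then 1 else 0)"

fun switching :: "real \<times> real \<times> real \<Rightarrow> real \<times> real \<times> real" where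
  "switching (c, v, r) =
     (heaviside v, heaviside c * heaviside v, heaviside v * heaviside r)"

text \<open>
  Right-hand sides of the equations for $\dot c_i$, $\dot v_i$, $\dot r_i$ at time \<open>t\<close>. The three
  components of \<open>g j s\<close> stand for $H(v_j)$, $H(c_j)H(v_j)$ and $H(v_j)H(r_j)$ at time \<open>s\<close>; they
  are written \<open>V\<close>, \<open>CV\<close> and \<open>VR\<close>.
\<close>

definition c_rate ::
    "real^'n \<Rightarrow> real^'n \<Rightarrow> ('n \<Rightarrow> real \<Rightarrow> real \<times> real \<times> real) \<Rightarrow> 'n \<Rightarrow> real \<Rightarrow> real" where
  "c_rate lam mu g i t =
     (let V = (\<lambda>j s. fst (g j s)); CV = (\<lambda>j s. fst (snd (g j s))) in
        lam $ i * (1 - V i t) + (lam $ i - mu $ i) * CV i t)"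

definition v_rate ::
    "real^'n \<Rightarrow> real^'n \<Rightarrow> real^'n^'n \<Rightarrow> real^'n^'n \<Rightarrow> real^'n^'n \<Rightarrow>
     ('n \<Rightarrow> real \<Rightarrow> real \<times> real \<times> real) \<Rightarrow> 'n \<Rightarrow> real \<Rightarrow> real" where
  "v_rate lam mu p T \<alpha> g i t =
     (let V = (\<lambda>j s. fst (g j s)); CV = (\<lambda>j s. fst (snd (g j s)));
          VR = (\<lambda>j s. snd (snd (g j s))) in
        - lam $ i * V i t + (lam $ i - mu $ i) * CV i t
        + (\<Sum>j\<in>UNIV - {i}. p $ j $ i *
             (lam $ j * V j (t - T $ j $ i) - (lam $ j - mu $ j) * CV j (t - T $ j $ i)))
        - rebalancing_rate \<alpha> i * VR i t
        + (\<Sum>j\<in>UNIV - {i}. \<alpha> $ j $ i * VR j (t - T $ j $ i)))"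

definition r_rate ::
    "real^'n^'n \<Rightarrow> real^'n^'n \<Rightarrow> real^'n^'n \<Rightarrow>
     ('n \<Rightarrow> real \<Rightarrow> real \<times> real \<times> real) \<Rightarrow> 'n \<Rightarrow> real \<Rightarrow> real" where
  "r_rate T \<alpha> \<beta> g i t =
     (let VR = (\<lambda>j s. snd (snd (g j s))) in
        - rebalancing_rate \<alpha> i * VR i t
        + (\<Sum>j\<in>UNIV - {i}. \<alpha> $ j $ i * VR j (t - T $ j $ i))
        - (\<Sum>j\<in>UNIV - {i}. \<beta> $ i $ j * VR i t)
        + (\<Sum>j\<in>UNIV - {i}. \<beta> $ j $ i * VR j (t - T $ j $ i)))"

text \<open>
  Evolutions live on \<open>[-max_travel_time T, \<infinity>)\<close>: nothing is required of \<open>c\<close>, \<open>v\<close>, \<open>r\<close>, \<open>g\<close> at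
  earlier times, and for \<open>t \<ge> 0\<close> no earlier value enters the equations.
\<close>

definition evolution ::
    "real^'n \<Rightarrow> real^'n \<Rightarrow> real^'n^'n \<Rightarrow> real^'n^'n \<Rightarrow> real^'n^'n \<Rightarrow> real^'n^'n \<Rightarrow>
     (real \<Rightarrow> real^'n) \<Rightarrow> (real \<Rightarrow> real^'n) \<Rightarrow> (real \<Rightarrow> real^'n) \<Rightarrow> bool" where
  "evolution lam mu p T \<alpha> \<beta> c v r \<longleftrightarrow>
     locally_absolutely_continuous_nonneg c \<and>
     locally_absolutely_continuous_nonneg v \<and>
     locally_absolutely_continuous_nonneg r \<and>
     (\<exists>g. (\<forall>i. g i \<in> borel_measurable (lebesgue_on {0..})) \<and>
          (\<forall>i. \<forall>t\<ge>0. g i t \<in> filippov switching (c t $ i, v t $ i, r t $ i)) \<and>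
          (\<forall>i. \<forall>t\<in>{- max_travel_time T..<0}. g i t = switching (c t $ i, v t $ i, r t $ i)) \<and>
          (AE t in lebesgue. t \<ge> 0 \<longrightarrow> (\<forall>i.
             ((\<lambda>s. c s $ i) has_real_derivative c_rate lam mu g i t) (at t within {0..}) \<and>
             ((\<lambda>s. v s $ i) has_real_derivative v_rate lam mu p T \<alpha> g i t) (at t within {0..}) \<and>
             ((\<lambda>s. r s $ i) has_real_derivative r_rate T \<alpha> \<beta> g i t) (at t within {0..}))))"


subsection \<open>Equilibria and local asymptotic stability\<close>

definition equilibria ::
    "real^'n \<Rightarrow> real^'n^'n \<Rightarrow> real^'n^'n \<Rightarrow> real \<Rightarrow> real \<Rightarrow> real^'n^'n \<Rightarrow> real^'n^'n \<Rightarrow>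
     ((real^'n) \<times> (real^'n) \<times> (real^'n)) set" where
  "equilibria lam p T V R \<alpha> \<beta> =
     {(c, v, r). (\<forall>i. c $ i = 0 \<and> v $ i > 0 \<and> r $ i > 0) \<and>
        (\<Sum>i\<in>UNIV. v $ i) = V - V_required lam p T \<alpha> \<and>
        (\<Sum>i\<in>UNIV. r $ i) = R - R_required T \<alpha> \<beta>}"

text \<open>The norm on the product type is the Euclidean norm of $\mathbb R^{3n}$.\<close>

definition initial_ball ::
    "real^'n \<Rightarrow> real^'n^'n \<Rightarrow> real^'n^'n \<Rightarrow> real \<Rightarrow> real \<Rightarrow> real^'n^'n \<Rightarrow> real^'n^'n \<Rightarrow>
     real \<Rightarrow> (real^'n) \<times> (real^'n) \<times> (real^'n) \<Rightarrow> ((real^'n) \<times> (real^'n) \<times> (real^'n)) set" where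
  "initial_ball lam p T V R \<alpha> \<beta> \<delta> e =
     {(c, v, r). (\<forall>i. c $ i \<ge> 0 \<and> v $ i \<ge> 0 \<and> r $ i \<ge> 0) \<and>
        norm ((c, v, r) - e) < \<delta> \<and>
        (\<Sum>i\<in>UNIV. v $ i) = V - V_required lam p T \<alpha> \<and>
        (\<Sum>i\<in>UNIV. r $ i) = R - R_required T \<alpha> \<beta>}"

definition equilibria_locally_asymptotically_stable ::
    "real^'n \<Rightarrow> real^'n \<Rightarrow> real^'n^'n \<Rightarrow> real^'n^'n \<Rightarrow> real \<Rightarrow> real \<Rightarrow>
     real^'n^'n \<Rightarrow> real^'n^'n \<Rightarrow> bool" where
  "equilibria_locally_asymptotically_stable lam mu p T V R \<alpha> \<beta> \<longleftrightarrow>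
     (\<forall>c0 v0 r0. (c0, v0, r0) \<in> equilibria lam p T V R \<alpha> \<beta> \<longrightarrow>
       (\<exists>\<delta>>0. \<forall>c v r.
          evolution lam mu p T \<alpha> \<beta> c v r \<and>
          (\<forall>\<tau>\<in>{- max_travel_time T..<0}. c \<tau> = c0 \<and> v \<tau> = v0 \<and> r \<tau> = r0) \<and>
          (c 0, v 0, r 0) \<in> initial_ball lam p T V R \<alpha> \<beta> \<delta> (c0, v0, r0)
          \<longrightarrow> (\<exists>c_lim v_lim r_lim.
                 (c \<longlongrightarrow> c_lim) at_top \<and> (v \<longlongrightarrow> v_lim) at_top \<and> (r \<longlongrightarrow> r_lim) at_top \<and>
                 (c_lim, v_lim, r_lim) \<in> equilibria lam p T V R \<alpha> \<beta>)))"

end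

theory Submission
  imports Defs
begin

text \<open>
  As long as all \<open>v\<^sub>i\<close> and \<open>r\<^sub>i\<close> are positive, the Filippov regularization leaves only the switch
  \<open>H(c\<^sub>i)H(v\<^sub>i)\<close> undetermined. Then \<open>c\<^sub>i\<close> decreases at rate \<open>\<mu>\<^sub>i - \<lambda>\<^sub>i\<close> until it reaches 0 and stays
  there, the balance equations of the assignment make \<open>r\<^sub>i\<close> constant, and \<open>v\<^sub>i\<close> differs from its
  initial value only by the queued customers served so far at \<open>i\<close> and those that have arrived at \<open>i\<close>.
  Hence \<open>v\<^sub>i(t) \<ge> v\<^sub>i(0) - c\<^sub>i(0)\<close>, so for a small perturbation \<open>v\<close> and \<open>r\<close> never leave the
  positive region, and the state is constant once all queues are empty and the last of the
  corresponding trips has ended.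
\<close>

section \<open>Absolutely continuous functions and increment bounds from almost-everywhere
  derivatives\<close>

lemma absolutely_continuous_on_subset:
  assumes "absolutely_continuous_on S u" "S' \<subseteq> S"
  shows "absolutely_continuous_on S' u"
  unfolding absolutely_continuous_on_def
proof (intro allI impI)
  fix e :: real assume "e > 0"
  then obtain d where "d > 0" and d: "\<And>I. finite I \<and> (\<forall>(a, b)\<in>I. a < b \<and> {a..b} \<subseteq> S) \<and>
        pairwise (\<lambda>(a, b) (a', b'). {a<..<b} \<inter> {a'<..<b'} = {}) I \<and>
        (\<Sum>(a, b)\<in>I. b - a) < d \<Longrightarrow> (\<Sum>(a, b)\<in>I. dist (u a) (u b)) < e"
    using assms(1) unfolding absolutely_continuous_on_def by meson
  have "(\<forall>(a, b)\<in>I. a < b \<and> {a..b} \<subseteq> S') \<Longrightarrow> (\<forall>(a, b)\<in>I. a < b \<and> {a..b} \<subseteq> S)" for I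
    using assms(2) by blast
  then show "\<exists>d>0. \<forall>I. finite I \<and> (\<forall>(a, b)\<in>I. a < b \<and> {a..b} \<subseteq> S') \<and>
        pairwise (\<lambda>(a, b) (a', b'). {a<..<b} \<inter> {a'<..<b'} = {}) I \<and>
        (\<Sum>(a, b)\<in>I. b - a) < d \<longrightarrow> (\<Sum>(a, b)\<in>I. dist (u a) (u b)) < e"
    using d \<open>d > 0\<close> by meson
qed

text \<open>Serves to pass from a vector-valued function to its coordinates and from a function to
  its negation.\<close>

lemma absolutely_continuous_on_dist_le:
  assumes "absolutely_continuous_on S u" "\<And>x y. dist (w x) (w y) \<le> dist (u x) (u y)"
  shows "absolutely_continuous_on S w"
  unfolding absolutely_continuous_on_def
proof (intro allI impI)
  fix e :: real assume "e > 0"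
  then obtain d where "d > 0" and d: "\<And>I. finite I \<and> (\<forall>(a, b)\<in>I. a < b \<and> {a..b} \<subseteq> S) \<and>
        pairwise (\<lambda>(a, b) (a', b'). {a<..<b} \<inter> {a'<..<b'} = {}) I \<and>
        (\<Sum>(a, b)\<in>I. b - a) < d \<Longrightarrow> (\<Sum>(a, b)\<in>I. dist (u a) (u b)) < e"
    using assms(1) unfolding absolutely_continuous_on_def by meson
  have "(\<Sum>(a, b)\<in>I. dist (w a) (w b)) \<le> (\<Sum>(a, b)\<in>I. dist (u a) (u b))" for I
    by (rule sum_mono) (auto intro: assms(2))
  then show "\<exists>d>0. \<forall>I. finite I \<and> (\<forall>(a, b)\<in>I. a < b \<and> {a..b} \<subseteq> S) \<and>
        pairwise (\<lambda>(a, b) (a', b'). {a<..<b} \<inter> {a'<..<b'} = {}) I \<and>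
        (\<Sum>(a, b)\<in>I. b - a) < d \<longrightarrow> (\<Sum>(a, b)\<in>I. dist (w a) (w b)) < e"
    using d \<open>d > 0\<close> by (meson order_le_less_trans)
qed

lemma absolutely_continuous_on_add:
  fixes u w :: "real \<Rightarrow> 'a::real_normed_vector"
  assumes "absolutely_continuous_on S u" "absolutely_continuous_on S w"
  shows "absolutely_continuous_on S (\<lambda>x. u x + w x)"
  unfolding absolutely_continuous_on_def
proof (intro allI impI)
  fix e :: real assume "e > 0"
  then have "e / 2 > 0" by simp
  then obtain d1 where "d1 > 0" and d1: "\<And>I. finite I \<and> (\<forall>(a, b)\<in>I. a < b \<and> {a..b} \<subseteq> S) \<and>
        pairwise (\<lambda>(a, b) (a', b'). {a<..<b} \<inter> {a'<..<b'} = {}) I \<and>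
        (\<Sum>(a, b)\<in>I. b - a) < d1 \<Longrightarrow> (\<Sum>(a, b)\<in>I. dist (u a) (u b)) < e / 2"
    using assms(1) unfolding absolutely_continuous_on_def by meson
  obtain d2 where "d2 > 0" and d2: "\<And>I. finite I \<and> (\<forall>(a, b)\<in>I. a < b \<and> {a..b} \<subseteq> S) \<and>
        pairwise (\<lambda>(a, b) (a', b'). {a<..<b} \<inter> {a'<..<b'} = {}) I \<and>
        (\<Sum>(a, b)\<in>I. b - a) < d2 \<Longrightarrow> (\<Sum>(a, b)\<in>I. dist (w a) (w b)) < e / 2"
    using assms(2) \<open>e / 2 > 0\<close> unfolding absolutely_continuous_on_def by meson
  have le: "(\<Sum>(a, b)\<in>I. dist (u a + w a) (u b + w b))
      \<le> (\<Sum>(a, b)\<in>I. dist (u a) (u b)) + (\<Sum>(a, b)\<in>I. dist (w a) (w b))" for I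
    unfolding sum.distrib[symmetric] by (rule sum_mono) (auto simp: dist_triangle_add)
  show "\<exists>d>0. \<forall>I. finite I \<and> (\<forall>(a, b)\<in>I. a < b \<and> {a..b} \<subseteq> S) \<and>
        pairwise (\<lambda>(a, b) (a', b'). {a<..<b} \<inter> {a'<..<b'} = {}) I \<and>
        (\<Sum>(a, b)\<in>I. b - a) < d \<longrightarrow> (\<Sum>(a, b)\<in>I. dist (u a + w a) (u b + w b)) < e"
  proof (intro exI[of _ "min d1 d2"] conjI allI impI)
    fix I assume I: "finite I \<and> (\<forall>(a, b)\<in>I. a < b \<and> {a..b} \<subseteq> S) \<and>
        pairwise (\<lambda>(a, b) (a', b'). {a<..<b} \<inter> {a'<..<b'} = {}) I \<and>
        (\<Sum>(a, b)\<in>I. b - a) < min d1 d2"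
    show "(\<Sum>(a, b)\<in>I. dist (u a + w a) (u b + w b)) < e"
      using d1[of I] d2[of I] le[of I] I by linarith
  qed (use \<open>d1 > 0\<close> \<open>d2 > 0\<close> in auto)
qed

lemma lipschitz_on_imp_absolutely_continuous_on:
  assumes "L-lipschitz_on S u"
  shows "absolutely_continuous_on S u"
  unfolding absolutely_continuous_on_def
proof (intro allI impI)
  fix e :: real assume "e > 0"
  have "L \<ge> 0" by (rule lipschitz_on_nonneg[OF assms])
  show "\<exists>d>0. \<forall>I. finite I \<and> (\<forall>(a, b)\<in>I. a < b \<and> {a..b} \<subseteq> S) \<and>
        pairwise (\<lambda>(a, b) (a', b'). {a<..<b} \<inter> {a'<..<b'} = {}) I \<and>
        (\<Sum>(a, b)\<in>I. b - a) < d \<longrightarrow> (\<Sum>(a, b)\<in>I. dist (u a) (u b)) < e"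
  \<comment> \<open>\<open>L\<close> may be 0, so \<open>L + 1\<close> serves as the
    divisor.\<close>
  proof (intro exI[of _ "e / (L + 1)"] conjI allI impI)
    fix I assume I: "finite I \<and> (\<forall>(a, b)\<in>I. a < b \<and> {a..b} \<subseteq> S) \<and>
        pairwise (\<lambda>(a, b) (a', b'). {a<..<b} \<inter> {a'<..<b'} = {}) I \<and>
        (\<Sum>(a, b)\<in>I. b - a) < e / (L + 1)"
    have "(\<Sum>(a, b)\<in>I. dist (u a) (u b)) \<le> (\<Sum>(a, b)\<in>I. (L + 1) * (b - a))"
    proof (rule sum_mono, clarify)
      fix a b assume "(a, b) \<in> I"
      then have ab: "a < b" "{a..b} \<subseteq> S" using I by auto
      then have "dist (u a) (u b) \<le> L * dist a b"
        by (intro lipschitz_onD[OF assms]) auto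
      also have "\<dots> \<le> (L + 1) * (b - a)"
        using ab \<open>L \<ge> 0\<close> by (auto simp: dist_real_def algebra_simps)
      finally show "dist (u a) (u b) \<le> (L + 1) * (b - a)" .
    qed
    also have "\<dots> = (L + 1) * (\<Sum>(a, b)\<in>I. b - a)"
      by (simp add: sum_distrib_left case_prod_unfold)
    also have "\<dots> < e"
      using I \<open>L \<ge> 0\<close> by (simp add: pos_less_divide_eq mult.commute)
    finally show "(\<Sum>(a, b)\<in>I. dist (u a) (u b)) < e" .
  qed (use \<open>e > 0\<close> \<open>L \<ge> 0\<close> in auto)
qed

lemma absolutely_continuous_on_imp_continuous_on:
  assumes "absolutely_continuous_on {a..b} u"
  shows "continuous_on {a..b} u"
  unfolding continuous_on_iff
proof (intro ballI allI impI)
  fix x e :: real assume x: "x \<in> {a..b}" and "e > 0"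
  then obtain d where "d > 0" and d: "\<And>I. finite I \<and> (\<forall>(a', b')\<in>I. a' < b' \<and> {a'..b'} \<subseteq> {a..b}) \<and>
        pairwise (\<lambda>(a, b) (a', b'). {a<..<b} \<inter> {a'<..<b'} = {}) I \<and>
        (\<Sum>(a, b)\<in>I. b - a) < d \<Longrightarrow> (\<Sum>(a, b)\<in>I. dist (u a) (u b)) < e"
    using assms unfolding absolutely_continuous_on_def by meson
  \<comment> \<open>The single interval between \<open>x\<close> and \<open>y\<close>, in whichever
    order they stand, is an admissible family.\<close>
  have "dist (u y) (u x) < e" if y: "y \<in> {a..b}" "dist y x < d" for y
    using d[of "{(x, y)}"] d[of "{(y, x)}"] x y \<open>e > 0\<close>
    by (cases x y rule: linorder_cases) (auto simp: dist_real_def dist_commute)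
  then show "\<exists>d>0. \<forall>y\<in>{a..b}. dist y x < d \<longrightarrow> dist (u y) (u x) < e"
    using \<open>d > 0\<close> by blast
qed

text \<open>
  Cousin's lemma supplies a fine tagged division. Intervals tagged outside \<open>N\<close> are controlled by the
  derivative; those tagged in \<open>N\<close> lie in an open set of small measure and are controlled by absolute
  continuity.
\<close>

lemma absolutely_continuous_on_nonincreasing:
  fixes u :: "real \<Rightarrow> real"
  assumes "a \<le> b" "absolutely_continuous_on {a..b} u" "negligible N"
    and deriv: "\<And>x. x \<in> {a..b} - N \<Longrightarrow> \<exists>D\<le>0. (u has_real_derivative D) (at x within {a..b})"
  shows "u b \<le> u a"
proof (rule field_le_epsilon)
  fix e0 :: real assume "e0 > 0"
  \<comment> \<open>Intervals tagged outside \<open>N\<close> will contribute at most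
    \<open>e * (b - a)\<close> and those tagged in \<open>N\<close> at most \<open>e\<close>;
    together this is \<open>e0\<close>.\<close>
  define e where "e = e0 / (b - a + 1)"
  have "e > 0" using \<open>e0 > 0\<close> \<open>a \<le> b\<close> by (simp add: e_def)
  then obtain d where "d > 0" and d: "\<And>I. finite I \<and> (\<forall>(a', b')\<in>I. a' < b' \<and> {a'..b'} \<subseteq> {a..b}) \<and>
        pairwise (\<lambda>(a, b) (a', b'). {a<..<b} \<inter> {a'<..<b'} = {}) I \<and>
        (\<Sum>(a, b)\<in>I. b - a) < d \<Longrightarrow> (\<Sum>(a, b)\<in>I. dist (u a) (u b)) < e"
    using assms(2) unfolding absolutely_continuous_on_def by meson
  obtain U where U0: "open U" "N \<subseteq> U" "U - N \<in> lmeasurable" "emeasure lebesgue (U - N) < ennreal d"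
    using sets_lebesgue_outer_open[of N d] negligible_imp_sets[OF assms(3)] \<open>d > 0\<close> by blast
  \<comment> \<open>Outer regularity bounds only the measure of \<open>U - N\<close>; as
    \<open>N\<close> is null, the bound carries over to \<open>U\<close>.\<close>
  have U: "open U" "N \<subseteq> U" "U \<in> lmeasurable" "measure lebesgue U < d"
  proof -
    have N: "N \<in> null_sets lebesgue" using assms(3) negligible_iff_null_sets by blast
    have "(U - N) \<union> N \<in> lmeasurable"
      using U0(3) negligible_imp_measurable[OF assms(3)] by (rule fmeasurable.Un)
    also have UN: "(U - N) \<union> N = U" using U0(2) by blast
    finally show U: "U \<in> lmeasurable" .
    have "measure lebesgue U = measure lebesgue (U - N)"
      using measure_Diff_null_set[OF _ N, of U] U by auto
    then show "measure lebesgue U < d"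
      using U0(3,4) \<open>d > 0\<close> by (simp add: emeasure_eq_measure2 ennreal_less_iff)
  qed (use U0 in auto)
  \<comment> \<open>The two sides of \<open>x\<close> are estimated separately because each interval
    of the division contains its tag and will be split there.\<close>
  have "\<exists>r>0. x \<in> {a..b} - N \<longrightarrow> (\<forall>y\<in>{a..b}. \<bar>y - x\<bar> < r \<longrightarrow>
      (y \<ge> x \<longrightarrow> u y - u x \<le> e * (y - x)) \<and> (y \<le> x \<longrightarrow> u x - u y \<le> e * (x - y)))" for x
  proof (cases "x \<in> {a..b} - N")
    case True
    then obtain D where "D \<le> 0" and D: "(u has_real_derivative D) (at x within {a..b})"
      using deriv by blast
    obtain r where "r > 0" and r: "\<And>y. y \<in> {a..b} \<Longrightarrow> \<bar>y - x\<bar> < r \<Longrightarrow>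
        \<bar>u y - u x - D * (y - x)\<bar> \<le> e * \<bar>y - x\<bar>"
      using D[unfolded has_field_derivative_def has_derivative_within_alt] \<open>e > 0\<close>
      by (auto simp: real_norm_def)
    have "u y - u x \<le> e * (y - x)" if "y \<in> {a..b}" "\<bar>y - x\<bar> < r" "y \<ge> x" for y
      using r[OF that(1,2)] that(3) mult_nonpos_nonneg[OF \<open>D \<le> 0\<close>, of "y - x"] by auto
    moreover have "u x - u y \<le> e * (x - y)" if "y \<in> {a..b}" "\<bar>y - x\<bar> < r" "y \<le> x" for y
      using r[OF that(1,2)] that(3) mult_nonpos_nonpos[OF \<open>D \<le> 0\<close>, of "y - x"] by auto
    ultimately show ?thesis using \<open>r > 0\<close> by blast
  qed (auto intro: exI[of _ 1])
  then obtain r where r0: "\<And>x. r x > 0" and r: "\<And>x y. x \<in> {a..b} - N \<Longrightarrow> y \<in> {a..b} \<Longrightarrow>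
      \<bar>y - x\<bar> < r x \<Longrightarrow> (y \<ge> x \<longrightarrow> u y - u x \<le> e * (y - x)) \<and> (y \<le> x \<longrightarrow> u x - u y \<le> e * (x - y))"
    by metis
  \<comment> \<open>A fine division has every interval tagged in \<open>N\<close> inside
    \<open>U\<close>, and every other one inside the ball where the derivative estimate
    applies.\<close>
  define g where "g x = (if x \<in> N then U else ball x (r x))" for x
  have "gauge g"
    unfolding gauge_def g_def using U r0 by auto
  then obtain P where P: "P tagged_division_of {a..b}" "g fine P"
    by (rule fine_division_exists_real)
  note PD = tagged_division_ofD[OF P(1)]
  have K: "K = {Inf K..Sup K} \<and> Inf K \<le> x \<and> x \<le> Sup K \<and> {Inf K..Sup K} \<subseteq> {a..b} \<and> K \<subseteq> g x"
    if xK: "(x, K) \<in> P" for x K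
  proof -
    obtain l h where "K = {l..h}" using PD(4)[OF xK] by auto
    moreover have "x \<in> K" "K \<subseteq> {a..b}" using PD(2,3)[OF xK] by auto
    ultimately show ?thesis using fineD[OF P(2) xK] by auto
  qed
  \<comment> \<open>Degenerate intervals are dropped: absolute continuity speaks of
    \<open>a < b\<close> only, and with nonempty interiors disjointness makes the endpoint map
    injective on \<open>Q\<close>.\<close>
  define Q where "Q = {(x, K)\<in>P. x \<in> N \<and> Inf K < Sup K}"
  define I where "I = (\<lambda>(x, K). (Inf K, Sup K)) ` Q"
  have "finite Q"
    by (rule finite_subset[OF _ PD(1)]) (auto simp: Q_def)
  have disj: "{Inf K<..<Sup K} \<inter> {Inf K'<..<Sup K'} = {}"
    if "(x, K) \<in> P" "(x', K') \<in> P" "(x, K) \<noteq> (x', K')" for x K x' K'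
    using PD(5)[OF that] K[OF that(1)] K[OF that(2)] by (metis interior_atLeastAtMost_real)
  have inj: "inj_on (\<lambda>(x, K). (Inf K, Sup K)) Q"
  proof (rule inj_onI, clarify)
    fix x and K :: "real set" and x' and K' :: "real set"
    assume *: "(x, K) \<in> Q" "(x', K') \<in> Q" "Inf K = Inf K'" "Sup K = Sup K'"
    then have "{Inf K<..<Sup K} \<inter> {Inf K'<..<Sup K'} \<noteq> {}"
      by (auto simp: Q_def)
    then show "x = x' \<and> K = K'"
      using disj * unfolding Q_def by blast
  qed
  have pw: "pairwise (\<lambda>(a, b) (a', b'). {a<..<b} \<inter> {a'<..<b'} = {}) I"
    unfolding I_def pairwise_def Q_def using disj by fastforce
  \<comment> \<open>The total length equals the measure of a disjoint union of open intervals lying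
    in \<open>U\<close>, hence is below \<open>d\<close>.\<close>
  have "(\<Sum>(a, b)\<in>I. b - a) = (\<Sum>(a, b)\<in>I. measure lebesgue {a<..<b})"
    by (rule sum.cong) (auto simp: I_def Q_def)
  also have "\<dots> = measure lebesgue (\<Union>(a, b)\<in>I. {a<..<b})"
    using pw \<open>finite Q\<close>
    by (subst measure_UNION') (auto simp: I_def pairwise_def disjnt_def case_prod_unfold)
  also have "\<dots> \<le> measure lebesgue U"
  proof (rule measure_mono_fmeasurable)
    have "{Inf K<..<Sup K} \<subseteq> U" if "(x, K) \<in> Q" for x K
    proof -
      have "(x, K) \<in> P" "x \<in> N" using that by (auto simp: Q_def)
      then have "{Inf K..Sup K} \<subseteq> U" using K[of x K] by (simp add: g_def)
      then show ?thesis by (auto intro: greaterThanLessThan_subseteq_atLeastAtMost_iff[THEN iffD2])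
    qed
    then show "(\<Union>(a, b)\<in>I. {a<..<b}) \<subseteq> U" unfolding I_def by fastforce
    show "(\<Union>(a, b)\<in>I. {a<..<b}) \<in> sets lebesgue"
      using \<open>finite Q\<close> by (intro sets.finite_UN) (auto simp: I_def)
  qed (use U in auto)
  also have "\<dots> < d" by (rule U)
  finally have "(\<Sum>(a, b)\<in>I. dist (u a) (u b)) < e"
    using \<open>finite Q\<close> pw K by (intro d) (fastforce simp: I_def Q_def)
  moreover have "(\<Sum>(a, b)\<in>I. dist (u a) (u b)) = (\<Sum>(x, K)\<in>Q. dist (u (Inf K)) (u (Sup K)))"
    unfolding I_def by (subst sum.reindex[OF inj]) (simp add: case_prod_unfold)
  \<comment> \<open>Extension by zero from \<open>Q\<close> to \<open>P\<close> prepares a termwise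
    comparison.\<close>
  moreover have "\<dots> = (\<Sum>z\<in>P. if z \<in> Q then (case z of (x, K) \<Rightarrow> dist (u (Inf K)) (u (Sup K))) else 0)"
    using PD(1) by (subst sum.inter_restrict[symmetric]) (auto simp: Q_def intro!: sum.cong)
  moreover have "u b - u a = (\<Sum>(x, K)\<in>P. u (Sup K) - u (Inf K))"
    using additive_tagged_division_1[OF \<open>a \<le> b\<close> P(1), of u] by simp
  moreover have "\<dots> \<le> (\<Sum>z\<in>P. (case z of (x, K) \<Rightarrow> e * (Sup K - Inf K)) +
      (if z \<in> Q then (case z of (x, K) \<Rightarrow> dist (u (Inf K)) (u (Sup K))) else 0))"
  proof (rule sum_mono, clarify)
    fix x K assume xK: "(x, K) \<in> P"
    have le: "e * (Sup K - Inf K) \<ge> 0" using K[OF xK] \<open>e > 0\<close> by simp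
    show "u (Sup K) - u (Inf K) \<le> e * (Sup K - Inf K) +
        (if (x, K) \<in> Q then dist (u (Inf K)) (u (Sup K)) else 0)"
    proof (cases "x \<in> N")
      case True
      show ?thesis
      proof (cases "Inf K < Sup K")
        case True
        then have "(x, K) \<in> Q" using \<open>x \<in> N\<close> xK by (simp add: Q_def)
        then show ?thesis using le by (auto simp: dist_real_def)
      next
        case False
        then have "Inf K = Sup K" using K[OF xK] by auto
        then show ?thesis using le by auto
      qed
    next
      case False
      then have "K \<subseteq> ball x (r x)" "x \<in> {a..b} - N" using K[OF xK] by (auto simp: g_def)
      moreover have "Inf K \<in> K" "Sup K \<in> K" "Inf K \<in> {a..b}" "Sup K \<in> {a..b}"
        using K[OF xK] by (metis atLeastAtMost_iff order_refl order_trans subsetD)+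
      ultimately have "u (Sup K) - u x \<le> e * (Sup K - x)" "u x - u (Inf K) \<le> e * (x - Inf K)"
        using r[of x "Sup K"] r[of x "Inf K"] K[OF xK] by (auto simp: dist_real_def subset_iff abs_minus_commute)
      moreover have "(x, K) \<notin> Q" using False by (simp add: Q_def)
      ultimately show ?thesis by (simp add: algebra_simps)
    qed
  qed
  moreover have "(\<Sum>(x, K)\<in>P. e * (Sup K - Inf K)) = e * (b - a)"
    using additive_tagged_division_1[OF \<open>a \<le> b\<close> P(1), of "\<lambda>x. e * x"]
    by (simp add: algebra_simps)
  ultimately have "u b - u a \<le> e * (b - a) + e"
    by (simp add: sum.distrib)
  also have "\<dots> = e * (b - a + 1)" by (simp add: algebra_simps)
  also have "\<dots> = e0" using \<open>a \<le> b\<close> by (simp add: e_def)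
  finally show "u b \<le> u a + e0" by simp
qed

lemma absolutely_continuous_on_sum:
  fixes u :: "'i \<Rightarrow> real \<Rightarrow> 'a::real_normed_vector"
  assumes "\<And>i. i \<in> A \<Longrightarrow> absolutely_continuous_on S (u i)"
  shows "absolutely_continuous_on S (\<lambda>x. \<Sum>i\<in>A. u i x)"
  using assms
proof (induction A rule: infinite_finite_induct)
  case (insert i A)
  then show ?case by (simp add: absolutely_continuous_on_add)
qed (auto intro: lipschitz_on_imp_absolutely_continuous_on lipschitz_on_constant)

text \<open>Monotonicity is applied to \<open>u x - m * x\<close> and to \<open>l * x - u x\<close>.
  The case \<open>l = m = 0\<close> yields the conservation laws below.\<close>

lemma absolutely_continuous_on_increment_bounds:
  fixes u :: "real \<Rightarrow> real"
  assumes "a \<le> b" "absolutely_continuous_on {a..b} u" "negligible N"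
    and deriv: "\<And>x. x \<in> {a..b} - N \<Longrightarrow> \<exists>D. l \<le> D \<and> D \<le> m \<and> (u has_real_derivative D) (at x within {a..b})"
  shows "u b - u a \<in> {l * (b - a)..m * (b - a)}"
proof -
  have lin: "absolutely_continuous_on {a..b} (\<lambda>x. k * x)" for k :: real
    by (rule lipschitz_on_imp_absolutely_continuous_on[where L = "\<bar>k\<bar>"])
      (auto intro!: lipschitz_onI simp: dist_real_def abs_mult right_diff_distrib[symmetric])
  have neg: "absolutely_continuous_on {a..b} (\<lambda>x. - u x)"
    by (rule absolutely_continuous_on_dist_le[OF assms(2)]) (simp add: dist_minus)
  have "u b + (- m) * b \<le> u a + (- m) * a"
  proof (rule absolutely_continuous_on_nonincreasing[OF assms(1) _ assms(3)])
    fix x assume "x \<in> {a..b} - N"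
    then obtain D where D: "D \<le> m" "(u has_real_derivative D) (at x within {a..b})"
      using deriv by blast
    have "((\<lambda>x. u x + (- m) * x) has_real_derivative D + (- m)) (at x within {a..b})"
      by (rule derivative_eq_intros D | simp)+
    then show "\<exists>D\<le>0. ((\<lambda>x. u x + (- m) * x) has_real_derivative D) (at x within {a..b})"
      using D(1) by (intro exI[of _ "D + (- m)"]) auto
  qed (intro absolutely_continuous_on_add assms(2) lin)
  moreover have "- u b + l * b \<le> - u a + l * a"
  proof (rule absolutely_continuous_on_nonincreasing[OF assms(1) _ assms(3)])
    fix x assume "x \<in> {a..b} - N"
    then obtain D where D: "l \<le> D" "(u has_real_derivative D) (at x within {a..b})"
      using deriv by blast
    have "((\<lambda>x. - u x + l * x) has_real_derivative - D + l) (at x within {a..b})"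
      by (rule derivative_eq_intros D | simp)+
    then show "\<exists>D\<le>0. ((\<lambda>x. - u x + l * x) has_real_derivative D) (at x within {a..b})"
      using D(1) by (intro exI[of _ "- D + l"]) auto
  qed (intro absolutely_continuous_on_add neg lin)
  ultimately show ?thesis by (simp add: algebra_simps)
qed

section \<open>The Filippov regularization of the switching functions where vehicles and drivers are
  present\<close>

text \<open>The intersection is contained in its member for the radius \<delta> and the empty null
  set.\<close>

lemma filippov_subset:
  assumes "closed C" "convex C" "\<delta> > 0" "F ` ball x \<delta> \<subseteq> C"
  shows "filippov F x \<subseteq> C"
proof -
  have "filippov F x \<subseteq> closure (convex hull (F ` (ball x \<delta> - {})))"
    unfolding filippov_def using \<open>\<delta> > 0\<close> by blast
  also have "\<dots> \<subseteq> C"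
    using assms by (simp add: closure_minimal hull_minimal)
  finally show ?thesis .
qed

text \<open>On a small ball the vehicle and driver coordinates stay positive, so
  \<open>switching\<close> reduces there to \<open>(1, heaviside c', 1)\<close>. Only at
  \<open>c = 0\<close> does the middle component remain undetermined.\<close>

lemma filippov_switching:
  assumes g: "g \<in> filippov switching (c, v, r)" and "v > 0" "r > 0"
  shows "fst g = 1" "snd (snd g) = 1" "0 \<le> fst (snd g)" "fst (snd g) \<le> 1"
    "c > 0 \<Longrightarrow> fst (snd g) = 1" "c < 0 \<Longrightarrow> fst (snd g) = 0"
proof -
  have near: "\<bar>c' - c\<bar> < \<delta> \<and> \<bar>v' - v\<bar> < \<delta> \<and> \<bar>r' - r\<bar> < \<delta>"
    if "(c', v', r') \<in> ball (c, v, r) \<delta>" for c' v' r' \<delta>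
    using that dist_fst_le[of "(c, v, r)" "(c', v', r')"] dist_snd_le[of "(c, v, r)" "(c', v', r')"]
      dist_fst_le[of "(v, r)" "(v', r')"] dist_snd_le[of "(v, r)" "(v', r')"]
    by (auto simp: dist_real_def abs_minus_commute)
  \<comment> \<open>\<open>C\<close> collects the values of \<open>heaviside\<close> near
    \<open>c\<close>: it will be \<open>{0..1}\<close> in general, and \<open>{1}\<close> or
    \<open>{0}\<close> on the ball of radius \<open>\<bar>c\<bar>\<close> when \<open>c\<close> is
    nonzero.\<close>
  have mem: "g \<in> {1} \<times> C \<times> {1}"
    if "closed C" "convex C" "\<delta> > 0" "\<And>c'. \<bar>c' - c\<bar> < \<delta> \<Longrightarrow> heaviside c' \<in> C" for C \<delta>
  proof -
    have "filippov switching (c, v, r) \<subseteq> {1} \<times> C \<times> {1}"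
    proof (rule filippov_subset)
      show "switching ` ball (c, v, r) (min \<delta> (min v r)) \<subseteq> {1} \<times> C \<times> {1}"
        using that(4) by (auto simp: heaviside_def dest!: near)
    qed (use that assms(2,3) in \<open>auto intro: closed_Times convex_Times\<close>)
    then show ?thesis using g by blast
  qed
  have "g \<in> {1} \<times> {0..1} \<times> {1}"
    by (rule mem[of _ 1]) (auto simp: heaviside_def)
  then show "fst g = 1" "snd (snd g) = 1" "0 \<le> fst (snd g)" "fst (snd g) \<le> 1"
    by auto
  show "fst (snd g) = 1" if "c > 0"
    using mem[of "{1}" c] that by (auto simp: heaviside_def)
  show "fst (snd g) = 0" if "c < 0"
    using mem[of "{0}" "- c"] that by (auto simp: heaviside_def)
qed

section \<open>A single queue with a discontinuous service rate\<close>

text \<open>The rate \<open>- k * h\<close> is never positive, so the queue never grows. If it is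
  still positive at \<open>b\<close>, it was positive throughout and drained at the full rate
  \<open>k\<close>. It cannot become negative, since below zero the rate vanishes.\<close>

lemma draining_queue:
  fixes c h :: "real \<Rightarrow> real"
  assumes "b \<ge> 0" "k > 0" "absolutely_continuous_on {0..b} c" "negligible N" "c 0 \<ge> 0"
    and deriv: "\<And>t. t \<in> {0..b} - N \<Longrightarrow> (c has_real_derivative - k * h t) (at t within {0..b})"
    and h: "\<And>t. t \<in> {0..b} - N \<Longrightarrow> 0 \<le> h t \<and> h t \<le> 1"
    and h_pos: "\<And>t. t \<in> {0..b} - N \<Longrightarrow> c t > 0 \<Longrightarrow> h t = 1"
    and h_neg: "\<And>t. t \<in> {0..b} - N \<Longrightarrow> c t < 0 \<Longrightarrow> h t = 0"
  shows "k-lipschitz_on {0..b} c" "0 \<le> c b" "c b \<le> c 0" "c b > 0 \<Longrightarrow> k * b \<le> c 0"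
proof -
  \<comment> \<open>The set \<open>N'\<close> leaves room for one more exceptional point, the last
    time at which \<open>c\<close> is nonnegative.\<close>
  have inc: "c y - c x \<in> {- k * M * (y - x)..- k * m * (y - x)}"
    if "0 \<le> x" "x \<le> y" "y \<le> b" "negligible N'"
       "\<And>t. t \<in> {x..y} - (N \<union> N') \<Longrightarrow> m \<le> h t \<and> h t \<le> M" for x y m M N'
  proof (rule absolutely_continuous_on_increment_bounds)
    show "absolutely_continuous_on {x..y} c"
      using that by (intro absolutely_continuous_on_subset[OF assms(3)]) auto
    show "negligible (N \<union> N')" using \<open>negligible N\<close> \<open>negligible N'\<close> by (rule negligible_Un)
    fix t assume t: "t \<in> {x..y} - (N \<union> N')"
    then have "(c has_real_derivative - k * h t) (at t within {x..y})"
      using that by (intro has_field_derivative_subset[OF deriv]) auto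
    then show "\<exists>D\<ge>- k * M. D \<le> - k * m \<and> (c has_real_derivative D) (at t within {x..y})"
      using that(5)[OF t] \<open>k > 0\<close> by (intro exI[of _ "- k * h t"]) auto
  qed fact
  have lip: "- k * (y - x) \<le> c y - c x \<and> c y \<le> c x" if "0 \<le> x" "x \<le> y" "y \<le> b" for x y
    using inc[of x y "{}" 0 1] that h by auto
  show "k-lipschitz_on {0..b} c"
  proof (rule lipschitz_onI)
    fix x y assume "x \<in> {0..b}" "y \<in> {0..b}"
    then show "dist (c x) (c y) \<le> k * dist x y"
      using lip[of x y] lip[of y x] by (cases "x \<le> y") (auto simp: dist_real_def algebra_simps)
  qed (use \<open>k > 0\<close> in simp)
  show "c b \<le> c 0" using lip[of 0 b] \<open>b \<ge> 0\<close> by simp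
  show "k * b \<le> c 0" if "c b > 0"
  proof -
    have "c t > 0" if "t \<in> {0..b}" for t
      using lip[of t b] that \<open>c b > 0\<close> by auto
    then have "c b - c 0 \<in> {- k * 1 * (b - 0)..- k * 1 * (b - 0)}"
      using \<open>b \<ge> 0\<close> h_pos by (intro inc[where N' = "{}"]) auto
    then show ?thesis using that by simp
  qed
  show "0 \<le> c b"
  proof (rule ccontr)
    assume neg: "\<not> 0 \<le> c b"
    \<comment> \<open>\<open>Sup S\<close> is the last time with \<open>c\<close> nonnegative. After
      it \<open>h\<close> is 0, so \<open>c\<close> keeps its value up to \<open>b\<close>,
      contradicting \<open>c b < 0\<close>.\<close>
    define S where "S = {0..b} \<inter> c -` {0..}"
    have "closed S"
      unfolding S_def using absolutely_continuous_on_imp_continuous_on[OF assms(3)]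
      by (intro continuous_closed_preimage) auto
    moreover have "0 \<in> S" "bdd_above S" using assms(1,5) by (auto simp: S_def)
    ultimately have "Sup S \<in> S" by (intro closed_contains_Sup) auto
    then have s: "0 \<le> Sup S" "Sup S \<le> b" "c (Sup S) \<ge> 0" by (auto simp: S_def)
    have "c t < 0" if "t \<in> {Sup S..b} - {Sup S}" for t
    proof (rule ccontr)
      assume "\<not> c t < 0"
      then have "t \<in> S" using that s by (auto simp: S_def)
      then have "t \<le> Sup S" using \<open>bdd_above S\<close> by (rule cSup_upper)
      then show False using that by auto
    qed
    then have "c b - c (Sup S) \<in> {- k * 0 * (b - Sup S)..- k * 0 * (b - Sup S)}"
      using s h_neg by (intro inc[where N' = "{Sup S}"]) auto
    then show False using s neg by simp
  qed
qed

lemma AE_lebesgue_obtains_negligible: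
  assumes "AE x in lebesgue. P x"
  obtains N where "negligible N" "\<And>x. x \<notin> N \<Longrightarrow> P x"
  using assms unfolding eventually_ae_filter by (auto simp: negligible_iff_null_sets)

section \<open>The trajectory started near an equilibrium\<close>

text \<open>The triple \<open>(1, 0, 1)\<close> is the value of \<open>switching\<close> at an
  equilibrium, which is the history before time 0. The smallness of the perturbation enters only
  through \<open>v_init\<close> and \<open>r_init\<close>: each station has more vehicles than
  queued customers, and some drivers.\<close>

locale perturbed_equilibrium =
  fixes lam mu :: "real^'n" and p T \<alpha> \<beta> :: "real^'n^'n"
    and c v r :: "real \<Rightarrow> real^'n" and g :: "'n \<Rightarrow> real \<Rightarrow> real \<times> real \<times> real" and N :: "real set"
  assumes mu: "\<And>i. mu $ i > lam $ i"
    and p_nonneg: "\<And>i j. p $ i $ j \<ge> 0"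
    and T_nonneg: "\<And>i j. T $ i $ j \<ge> 0"
    and assignment: "assignment lam p \<alpha> \<beta>"
    and ac: "locally_absolutely_continuous_nonneg c"
      "locally_absolutely_continuous_nonneg v" "locally_absolutely_continuous_nonneg r"
    and selection: "\<And>i t. t \<ge> 0 \<Longrightarrow> g i t \<in> filippov switching (c t $ i, v t $ i, r t $ i)"
    and past: "\<And>i t. - max_travel_time T \<le> t \<Longrightarrow> t < 0 \<Longrightarrow> g i t = (1, 0, 1)"
    and negl: "negligible N"
    and deriv:
      "\<And>i t. t \<ge> 0 \<Longrightarrow> t \<notin> N \<Longrightarrow> ((\<lambda>s. c s $ i) has_real_derivative c_rate lam mu g i t) (at t within {0..})"
      "\<And>i t. t \<ge> 0 \<Longrightarrow> t \<notin> N \<Longrightarrow> ((\<lambda>s. v s $ i) has_real_derivative v_rate lam mu p T \<alpha> g i t) (at t within {0..})"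
      "\<And>i t. t \<ge> 0 \<Longrightarrow> t \<notin> N \<Longrightarrow> ((\<lambda>s. r s $ i) has_real_derivative r_rate T \<alpha> \<beta> g i t) (at t within {0..})"
    and c_init: "\<And>i. c 0 $ i \<ge> 0"
    and v_init: "\<And>i. v 0 $ i > c 0 $ i"
    and r_init: "\<And>i. r 0 $ i > 0"
begin

lemma T_le_max: "T $ i $ j \<le> max_travel_time T"
  unfolding max_travel_time_def by (rule Max_ge) (auto intro!: image_eqI[of _ _ "(i, j)"])

text \<open>The zero diagonal lets the full row sum in \<open>rebalancing_rate\<close> be compared
  with sums over the other stations. The two imbalances have opposite signs and will cancel in the
  driver equation.\<close>

lemma rebalancing_balance:
  "rebalancing_rate \<alpha> i - (\<Sum>j\<in>UNIV - {i}. \<alpha> $ j $ i) = demand_imbalance lam p i"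
  "(\<Sum>j\<in>UNIV - {i}. \<beta> $ i $ j) - (\<Sum>j\<in>UNIV - {i}. \<beta> $ j $ i) = - demand_imbalance lam p i"
  using assignment
  by (simp_all add: rebalancing_rate_def sum.remove[of _ i] assignment_def sum_subtractf)

lemma ac_component:
  assumes "locally_absolutely_continuous_nonneg (u :: real \<Rightarrow> real^'n)"
  shows "absolutely_continuous_on {0..b} (\<lambda>s. u s $ i)"
proof (cases "b \<ge> 0")
  case True
  then have "absolutely_continuous_on {0..b} u"
    using assms by (simp add: locally_absolutely_continuous_nonneg_def)
  then show ?thesis
    by (rule absolutely_continuous_on_dist_le)
      (metis dist_norm norm_bound_component_le_cart order_refl vector_minus_component real_norm_def)
next
  case False
  then show ?thesis
    by (auto intro!: lipschitz_on_imp_absolutely_continuous_on[of 0] lipschitz_onI)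
qed

lemma selection_positive:
  assumes "t \<ge> 0" "v t $ i > 0" "r t $ i > 0"
  shows "fst (g i t) = 1" "snd (snd (g i t)) = 1" "0 \<le> fst (snd (g i t))" "fst (snd (g i t)) \<le> 1"
    "c t $ i > 0 \<Longrightarrow> fst (snd (g i t)) = 1" "c t $ i < 0 \<Longrightarrow> fst (snd (g i t)) = 0"
  using filippov_switching[OF selection[OF assms(1)] assms(2,3)] by auto

text \<open>Positivity is assumed on the half-open interval only, while the conclusions hold at
  \<open>b\<close> itself. They can therefore be applied at a first exit time.\<close>

context
  fixes b :: real
  assumes b: "b \<ge> 0"
    and pos: "\<And>t i. 0 \<le> t \<Longrightarrow> t < b \<Longrightarrow> v t $ i > 0 \<and> r t $ i > 0"
begin

lemma customer_derivative:
  assumes "0 \<le> t" "t < b" "t \<notin> N"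
  shows "((\<lambda>s. c s $ i) has_real_derivative (lam $ i - mu $ i) * fst (snd (g i t))) (at t within {0..})"
  using deriv(1)[OF assms(1,3), of i] selection_positive[of t i] pos[OF assms(1,2), of i] assms(1)
  by (simp add: c_rate_def Let_def)

lemma customers:
  shows "(mu $ i - lam $ i)-lipschitz_on {0..b} (\<lambda>s. c s $ i)"
    and "0 \<le> c b $ i" "c b $ i \<le> c 0 $ i" "c b $ i > 0 \<Longrightarrow> (mu $ i - lam $ i) * b \<le> c 0 $ i"
proof -
  have neg: "negligible (insert b N)" using negl by simp
  have D: "((\<lambda>s. c s $ i) has_real_derivative - (mu $ i - lam $ i) * fst (snd (g i t))) (at t within {0..b})"
    if "t \<in> {0..b} - insert b N" for t
    using has_field_derivative_subset[OF customer_derivative[of t i], of "{0..b}"] that by auto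
  have s: "t \<ge> 0" "v t $ i > 0" "r t $ i > 0" if "t \<in> {0..b} - insert b N" for t
    using pos[of t i] that by auto
  have k: "mu $ i - lam $ i > 0" using mu[of i] by simp
  have h: "0 \<le> fst (snd (g i t)) \<and> fst (snd (g i t)) \<le> 1" if "t \<in> {0..b} - insert b N" for t
    using selection_positive(3,4)[OF s[OF that]] by auto
  note drain = draining_queue[OF b k ac_component[OF ac(1)] neg c_init D h
      selection_positive(5)[OF s] selection_positive(6)[OF s]]
  show "(mu $ i - lam $ i)-lipschitz_on {0..b} (\<lambda>s. c s $ i)" by (rule drain(1))
  show "0 \<le> c b $ i" by (rule drain(2))
  show "c b $ i \<le> c 0 $ i" by (rule drain(3))
  show "c b $ i > 0 \<Longrightarrow> (mu $ i - lam $ i) * b \<le> c 0 $ i" by (rule drain(4))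
qed

text \<open>Besides \<open>b\<close>, this excludes the times at which the current or a delayed time
  falls into \<open>N\<close>, and the kinks of \<open>max 0 (s - T $ j $ i)\<close>.\<close>

definition exceptional :: "real set" where
  "exceptional = insert b (N \<union> (\<Union>i. \<Union>j. insert (T $ i $ j) ((+) (T $ i $ j) ` N)))"

lemma negligible_exceptional: "negligible exceptional"
  unfolding exceptional_def using negl
  by (auto intro!: negligible_Union negligible_translation)

text \<open>Before the delay has elapsed, the history gives a zero middle component and
  \<open>c (max 0 (s - T $ j $ i)) $ j\<close> is constant. Afterwards the current-time facts are
  shifted by the delay.\<close>

lemma delayed:
  assumes t: "t \<in> {0..b} - exceptional"
  shows "fst (g j (t - T $ j $ i)) = 1" "snd (snd (g j (t - T $ j $ i))) = 1"
    "((\<lambda>s. c (max 0 (s - T $ j $ i)) $ j) has_real_derivative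
       (lam $ j - mu $ j) * fst (snd (g j (t - T $ j $ i)))) (at t within {0..b})"
proof -
  define d where "d = T $ j $ i"
  have d: "d \<ge> 0" "d \<le> max_travel_time T" using T_nonneg T_le_max by (auto simp: d_def)
  have t': "0 \<le> t" "t < b" "t \<noteq> d" "t - d \<notin> N"
    using t by (force simp: exceptional_def d_def image_iff)+
  have "fst (g j (t - d)) = 1 \<and> snd (snd (g j (t - d))) = 1 \<and>
    ((\<lambda>s. c (max 0 (s - d)) $ j) has_real_derivative
       (lam $ j - mu $ j) * fst (snd (g j (t - d)))) (at t within {0..b})"
  proof (cases "t < d")
    case True
    then have g: "g j (t - d) = (1, 0, 1)" using d t' by (intro past) auto
    have "((\<lambda>s. c (max 0 (s - d)) $ j) has_real_derivative 0) (at t within {0..b})"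
    proof (rule has_field_derivative_transform_within[where d = "d - t"])
      show "((\<lambda>s. c 0 $ j) has_real_derivative 0) (at t within {0..b})" by simp
    qed (use True t' in \<open>auto simp: dist_real_def max_def\<close>)
    then show ?thesis using g by simp
  next
    case False
    then have "t - d > 0" using t' by auto
    moreover have "t - d < b" using t' d by auto
    ultimately have g: "fst (g j (t - d)) = 1" "snd (snd (g j (t - d))) = 1"
      using selection_positive(1,2)[of "t - d" j] pos[of "t - d" j] by auto
    have "((\<lambda>s. c s $ j) has_real_derivative (lam $ j - mu $ j) * fst (snd (g j (t - d))))
        (at (t + (- d)) within {0..})"
      using customer_derivative[of "t - d" j] \<open>t - d > 0\<close> \<open>t - d < b\<close> t' by simp
    \<comment> \<open>The delayed time is interior to \<open>{0..}\<close>, so the derivative is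
      two-sided and may be translated.\<close>
    then have "((\<lambda>s. c s $ j) has_real_derivative (lam $ j - mu $ j) * fst (snd (g j (t - d))))
        (at (t + (- d)))"
      using \<open>t - d > 0\<close> by (subst (asm) at_within_interior) auto
    then have "((\<lambda>s. c (s + (- d)) $ j) has_real_derivative (lam $ j - mu $ j) * fst (snd (g j (t - d))))
        (at t within {0..b})"
      unfolding DERIV_shift by (rule has_field_derivative_at_within)
    then have "((\<lambda>s. c (max 0 (s - d)) $ j) has_real_derivative (lam $ j - mu $ j) * fst (snd (g j (t - d))))
        (at t within {0..b})"
      by (rule has_field_derivative_transform_within[where d = "t - d"])
        (use \<open>t - d > 0\<close> t' in \<open>auto simp: dist_real_def max_def\<close>)
    then show ?thesis using g by simp
  qed
  then show "fst (g j (t - T $ j $ i)) = 1" "snd (snd (g j (t - T $ j $ i))) = 1"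
    "((\<lambda>s. c (max 0 (s - T $ j $ i)) $ j) has_real_derivative
       (lam $ j - mu $ j) * fst (snd (g j (t - T $ j $ i)))) (at t within {0..b})"
    by (auto simp: d_def)
qed

text \<open>All switches in the driver equation equal 1, and the imbalances of \<alpha> and \<beta>
  cancel.\<close>

lemma drivers: "r b $ i = r 0 $ i"
proof -
  have "r b $ i - r 0 $ i \<in> {0 * (b - 0)..0 * (b - 0)}"
  proof (rule absolutely_continuous_on_increment_bounds[OF b ac_component[OF ac(3)] negligible_exceptional])
    fix t assume t: "t \<in> {0..b} - exceptional"
    then have t': "0 \<le> t" "t < b" "t \<notin> N" by (auto simp: exceptional_def)
    have g: "snd (snd (g i t)) = 1" using selection_positive(2) pos t' by blast
    have "r_rate T \<alpha> \<beta> g i t = 0"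
      using rebalancing_balance[of i] by (simp add: r_rate_def g delayed(2)[OF t])
    then have "((\<lambda>s. r s $ i) has_real_derivative 0) (at t within {0..b})"
      using has_field_derivative_subset[OF deriv(3)[OF t'(1,3), of i], of "{0..b}"] by auto
    then show "\<exists>D\<ge>0. D \<le> 0 \<and> ((\<lambda>s. r s $ i) has_real_derivative D) (at t within {0..b})"
      by blast
  qed
  then show ?thesis by simp
qed

text \<open>
  The conserved quantity is \<open>v\<^sub>i - c\<^sub>i + (\<Sum>j. p\<^sub>j\<^sub>i c\<^sub>j(max 0 (t - T\<^sub>j\<^sub>i)))\<close>: serving a queued customer takes one
  extra vehicle away from \<open>j\<close> and delivers it to \<open>i\<close> after the travel time. The maximum accounts
  for the empty queues before time 0.
\<close>

lemma vehicles:
  "v b $ i = v 0 $ i + (c b $ i - c 0 $ i)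
     + (\<Sum>j\<in>UNIV - {i}. p $ j $ i * (c 0 $ j - c (max 0 (b - T $ j $ i)) $ j))"
proof -
  define w where "w s = v s $ i + (- c s $ i) + (\<Sum>j\<in>UNIV - {i}. p $ j $ i * c (max 0 (s - T $ j $ i)) $ j)" for s
  have "w b - w 0 \<in> {0 * (b - 0)..0 * (b - 0)}"
  proof (rule absolutely_continuous_on_increment_bounds[OF b _ negligible_exceptional])
    have "absolutely_continuous_on {0..b} (\<lambda>s. - c s $ i)"
      by (rule absolutely_continuous_on_dist_le[OF ac_component[OF ac(1), where i = i]]) (simp add: dist_minus)
    \<comment> \<open>The Lipschitz bound on queues is used here because it composes directly with
      the clipped delay.\<close>
    moreover have "absolutely_continuous_on {0..b} (\<lambda>s. p $ j $ i * c (max 0 (s - T $ j $ i)) $ j)" for j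
    proof (rule lipschitz_on_imp_absolutely_continuous_on)
      have "1-lipschitz_on {0..b} (\<lambda>s. max 0 (s - T $ j $ i))"
        by (rule lipschitz_onI) (auto simp: dist_real_def max_def)
      moreover have "(mu $ j - lam $ j)-lipschitz_on ((\<lambda>s. max 0 (s - T $ j $ i)) ` {0..b}) (\<lambda>s. c s $ j)"
        by (rule lipschitz_on_subset[OF customers(1)]) (use T_nonneg[of j i] b in \<open>auto simp: max_def\<close>)
      ultimately show "(\<bar>p $ j $ i\<bar> * ((mu $ j - lam $ j) * 1))-lipschitz_on {0..b}
          (\<lambda>s. p $ j $ i * c (max 0 (s - T $ j $ i)) $ j)"
        by (intro lipschitz_on_cmult_real lipschitz_on_compose2[where f = "\<lambda>s. max 0 (s - T $ j $ i)"])
    qed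
    ultimately show "absolutely_continuous_on {0..b} w"
      unfolding w_def
      by (intro absolutely_continuous_on_add absolutely_continuous_on_sum ac_component[OF ac(2)])
    fix t assume t: "t \<in> {0..b} - exceptional"
    then have t': "0 \<le> t" "t < b" "t \<notin> N" by (auto simp: exceptional_def)
    have g: "fst (g i t) = 1" "snd (snd (g i t)) = 1" using selection_positive(1,2) pos t' by blast+
    have balance: "rebalancing_rate \<alpha> i - (\<Sum>j\<in>UNIV - {i}. \<alpha> $ j $ i)
        = - lam $ i + (\<Sum>j\<in>UNIV - {i}. lam $ j * p $ j $ i)"
      using rebalancing_balance(1) by (simp add: demand_imbalance_def)
    define D where "D j = (lam $ j - mu $ j) * fst (snd (g j (t - T $ j $ i)))" for j
    \<comment> \<open>The constant terms cancel by \<open>balance\<close>; only the extra departures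
      and arrivals due to queued customers remain.\<close>
    have "v_rate lam mu p T \<alpha> g i t = (lam $ i - mu $ i) * fst (snd (g i t)) - (\<Sum>j\<in>UNIV - {i}. p $ j $ i * D j)"
      using balance
      by (simp add: v_rate_def g delayed(1,2)[OF t] D_def right_diff_distrib sum_subtractf mult.commute)
    then have "((\<lambda>s. v s $ i) has_real_derivative
        (lam $ i - mu $ i) * fst (snd (g i t)) - (\<Sum>j\<in>UNIV - {i}. p $ j $ i * D j)) (at t within {0..b})"
      using has_field_derivative_subset[OF deriv(2)[OF t'(1,3), of i], of "{0..b}"] by auto
    moreover have "((\<lambda>s. - c s $ i) has_real_derivative
        - ((lam $ i - mu $ i) * fst (snd (g i t)))) (at t within {0..b})"
      by (rule DERIV_minus, rule has_field_derivative_subset[OF customer_derivative[OF t']]) auto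
    moreover have "((\<lambda>s. \<Sum>j\<in>UNIV - {i}. p $ j $ i * c (max 0 (s - T $ j $ i)) $ j) has_real_derivative
        (\<Sum>j\<in>UNIV - {i}. p $ j $ i * D j)) (at t within {0..b})"
      unfolding D_def by (intro DERIV_sum DERIV_cmult delayed(3)[OF t])
    ultimately have "(w has_real_derivative
        ((lam $ i - mu $ i) * fst (snd (g i t)) - (\<Sum>j\<in>UNIV - {i}. p $ j $ i * D j))
        + - ((lam $ i - mu $ i) * fst (snd (g i t))) + (\<Sum>j\<in>UNIV - {i}. p $ j $ i * D j)) (at t within {0..b})"
      unfolding w_def by (intro DERIV_add)
    then show "\<exists>D\<ge>0. D \<le> 0 \<and> (w has_real_derivative D) (at t within {0..b})"
      by (intro exI[of _ 0]) simp
  qed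
  moreover have "w 0 = v 0 $ i + (- c 0 $ i) + (\<Sum>j\<in>UNIV - {i}. p $ j $ i * c 0 $ j)"
    using T_nonneg by (simp add: w_def)
  ultimately show ?thesis by (simp add: w_def right_diff_distrib sum_subtractf)
qed

end

text \<open>At a first exit time \<open>b\<close> the conservation laws still hold. They give
  \<open>r b = r 0\<close> and \<open>v b $ k \<ge> v 0 $ k - c 0 $ k > 0\<close>, so no exit
  occurs.\<close>

lemma stays_positive:
  assumes "t \<ge> 0"
  shows "v t $ i > 0 \<and> r t $ i > 0"
proof (rule ccontr)
  assume neg: "\<not> ?thesis"
  define S where "S = (\<Union>i. {0..t} \<inter> (\<lambda>s. min (v s $ i) (r s $ i)) -` {..0})"
  have "closed S"
    unfolding S_def
    by (intro closed_UN finite continuous_closed_preimage continuous_on_min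
        absolutely_continuous_on_imp_continuous_on ac_component ac ballI) auto
  moreover have "t \<in> S" using neg assms by (auto simp: S_def min_le_iff_disj not_less)
  moreover have "bdd_below S" by (auto simp: S_def)
  ultimately have "Inf S \<in> S" by (intro closed_contains_Inf) auto
  define b where "b = Inf S"
  obtain k where k: "0 \<le> b" "b \<le> t" "v b $ k \<le> 0 \<or> r b $ k \<le> 0"
    using \<open>Inf S \<in> S\<close> by (auto simp: S_def b_def min_le_iff_disj)
  have pos: "v s $ j > 0 \<and> r s $ j > 0" if "0 \<le> s" "s < b" for s j
  proof (rule ccontr)
    assume "\<not> ?thesis"
    then have "s \<in> S" using that k by (auto simp: S_def min_le_iff_disj not_less)
    then have "b \<le> s" unfolding b_def using \<open>bdd_below S\<close> by (rule cInf_lower)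
    then show False using that by simp
  qed
  \<comment> \<open>The queue bound is applied at the delayed time, which does not exceed
    \<open>b\<close>.\<close>
  have le: "c (max 0 (b - T $ j $ k)) $ j \<le> c 0 $ j" for j
    using k(1) T_nonneg[of j k] by (intro customers(3) pos) (auto simp: max_def split: if_splits)
  have "(\<Sum>j\<in>UNIV - {k}. p $ j $ k * (c 0 $ j - c (max 0 (b - T $ j $ k)) $ j)) \<ge> 0"
    using le p_nonneg by (intro sum_nonneg mult_nonneg_nonneg) auto
  then have "v b $ k \<ge> v 0 $ k - c 0 $ k"
    using vehicles[OF k(1) pos, of k] customers(2)[OF k(1) pos, of k] by simp
  then show False
    using v_init[of k] r_init[of k] drivers[OF k(1) pos, of k] k(3) by simp
qed

text \<open>A queue still positive at time \<open>t\<close> would have drained at the full rate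
  since time 0.\<close>

lemma customers_vanish:
  assumes "t \<ge> 0" "t > c 0 $ i / (mu $ i - lam $ i)"
  shows "c t $ i = 0"
proof -
  have "\<not> c t $ i > 0"
    using customers(4)[of t i] stays_positive assms mu[of i] by (auto simp: field_simps)
  then show ?thesis using customers(2)[of t i] stays_positive assms by force
qed

lemma eventually_constant:
  "\<forall>\<^sub>F t in at_top. c t = 0 \<and> r t = r 0 \<and>
     v t = (\<chi> i. v 0 $ i - c 0 $ i + (\<Sum>j\<in>UNIV - {i}. p $ j $ i * c 0 $ j))"
proof -
  \<comment> \<open>After the longest trip plus the sum of all draining times, every current and
    delayed queue is empty; the summand 1 makes the inequality strict.\<close>
  define B where "B = max_travel_time T + (\<Sum>j\<in>UNIV. c 0 $ j / (mu $ j - lam $ j)) + 1"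
  have "c 0 $ j / (mu $ j - lam $ j) \<le> (\<Sum>j\<in>UNIV. c 0 $ j / (mu $ j - lam $ j))" for j
    using mu c_init by (intro member_le_sum) (auto intro!: divide_nonneg_nonneg simp: less_imp_le)
  then have B: "c 0 $ j / (mu $ j - lam $ j) < B - max_travel_time T" for j
    by (smt (verit) B_def)
  have max: "max_travel_time T \<ge> 0" using T_nonneg T_le_max by (meson order_trans)
  have nonneg: "c 0 $ j / (mu $ j - lam $ j) \<ge> 0" for j
    using mu[of j] c_init[of j] by simp
  show ?thesis
    unfolding eventually_at_top_linorder
  proof (intro exI[of _ B] allI impI conjI)
    fix t assume "t \<ge> B"
    then have t: "t \<ge> 0" "t - d > c 0 $ j / (mu $ j - lam $ j)" "t - d \<ge> 0" if "0 \<le> d" "d \<le> max_travel_time T" for d j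
      using B[of j] nonneg[of j] max that by linarith+
    have t0: "t \<ge> 0" using t(1)[of 0] max by simp
    have c0: "c t $ i = 0" for i
      using t(2)[of 0 i] max by (intro customers_vanish t0) auto
    then show "c t = 0" by (simp add: vec_eq_iff)
    show "r t = r 0"
      using drivers[OF t0] stays_positive by (simp add: vec_eq_iff)
    have c1: "c (max 0 (t - T $ j $ i)) $ j = 0" for i j
      using t(2)[OF T_nonneg T_le_max, of j j i] t(3)[OF T_nonneg T_le_max, of j i]
      by (simp add: customers_vanish)
    show "v t = (\<chi> i. v 0 $ i - c 0 $ i + (\<Sum>j\<in>UNIV - {i}. p $ j $ i * c 0 $ j))"
      using vehicles[OF t0] stays_positive by (simp add: vec_eq_iff c0 c1)
  qed
qed

end

section \<open>Local asymptotic stability of the equilibrium set\<close>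

lemma switching_at_equilibrium:
  assumes "(c0, v0, r0) \<in> equilibria lam p T V R \<alpha> \<beta>"
  shows "switching (c0 $ i, v0 $ i, r0 $ i) = (1, 0, 1)"
  using assms by (simp add: equilibria_def heaviside_def)

theorem mainTheorem4:
  fixes lam mu :: "real^'n"
    and p T f \<alpha> \<beta> :: "real^'n^'n"
    and V R :: real
  assumes "\<And>i. lam $ i > 0"
    and "\<And>i. mu $ i > lam $ i"
    and "\<And>i j. p $ i $ j \<ge> 0"
    and "\<And>i. p $ i $ i = 0"
    and "\<And>i. (\<Sum>j\<in>UNIV. p $ i $ j) = 1"
    and "\<And>i j. T $ i $ j \<ge> 0"
    and "\<And>i j. 0 < f $ i $ j \<and> f $ i $ j \<le> 1"
    and "V > 0"
    and "R > 0"
    and "\<And>i. demand_imbalance lam p i \<noteq> 0"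
    and "feasible_assignment lam p f \<alpha> \<beta>"
    and "V > V_required lam p T \<alpha>"
    and "R > R_required T \<alpha> \<beta>"
  shows "equilibria_locally_asymptotically_stable lam mu p T V R \<alpha> \<beta>"
  unfolding equilibria_locally_asymptotically_stable_def
proof (intro allI impI)
  fix c0 v0 r0 :: "real^'n"
  assume eq: "(c0, v0, r0) \<in> equilibria lam p T V R \<alpha> \<beta>"
  then have eq0: "c0 $ i = 0" "v0 $ i > 0" "r0 $ i > 0" for i
    by (auto simp: equilibria_def)
  \<comment> \<open>Half of \<open>v0 $ i\<close> is allotted to the change of \<open>v\<close> and
    half to the size of \<open>c\<close>, which gives \<open>v 0 $ i > c 0 $ i\<close>; the bound by
    \<open>r0 $ i\<close> keeps \<open>r 0 $ i\<close> positive.\<close>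
  define \<delta> where "\<delta> = Min (range (\<lambda>i. min (v0 $ i / 2) (r0 $ i)))"
  have \<delta>: "\<delta> \<le> v0 $ i / 2" "\<delta> \<le> r0 $ i" for i
    using Min_le[of "range (\<lambda>i. min (v0 $ i / 2) (r0 $ i))" "min (v0 $ i / 2) (r0 $ i)"]
    by (auto simp: \<delta>_def)
  have "\<delta> > 0"
    unfolding \<delta>_def using eq0 by (subst Min_gr_iff) auto
  moreover have "\<exists>c_lim v_lim r_lim.
      (c \<longlongrightarrow> c_lim) at_top \<and> (v \<longlongrightarrow> v_lim) at_top \<and> (r \<longlongrightarrow> r_lim) at_top \<and>
      (c_lim, v_lim, r_lim) \<in> equilibria lam p T V R \<alpha> \<beta>"
    if ev: "evolution lam mu p T \<alpha> \<beta> c v r"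
      and past: "\<forall>\<tau>\<in>{- max_travel_time T..<0}. c \<tau> = c0 \<and> v \<tau> = v0 \<and> r \<tau> = r0"
      and init: "(c 0, v 0, r 0) \<in> initial_ball lam p T V R \<alpha> \<beta> \<delta> (c0, v0, r0)" for c v r
  proof -
    have norm: "norm (c 0 - c0, v 0 - v0, r 0 - r0) < \<delta>"
      and nonneg: "c 0 $ i \<ge> 0"
      and sums: "(\<Sum>i\<in>UNIV. v 0 $ i) = V - V_required lam p T \<alpha>"
        "(\<Sum>i\<in>UNIV. r 0 $ i) = R - R_required T \<alpha> \<beta>" for i
      using init by (auto simp: initial_ball_def)
    have "norm (c 0 - c0) < \<delta>" "norm (v 0 - v0) < \<delta>" "norm (r 0 - r0) < \<delta>"
      using norm norm_fst_le[of "c 0 - c0" "(v 0 - v0, r 0 - r0)"]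
        norm_snd_le[of "(v 0 - v0, r 0 - r0)" "c 0 - c0"]
        norm_fst_le[of "v 0 - v0" "r 0 - r0"] norm_snd_le[of "r 0 - r0" "v 0 - v0"]
      by linarith+
    then have near: "\<bar>c 0 $ i\<bar> < \<delta>" "\<bar>v 0 $ i - v0 $ i\<bar> < \<delta>" "\<bar>r 0 $ i - r0 $ i\<bar> < \<delta>" for i
      using component_le_norm_cart[of "c 0 - c0" i] component_le_norm_cart[of "v 0 - v0" i]
        component_le_norm_cart[of "r 0 - r0" i] eq0[of i] by auto
    obtain g where g: "\<And>i t. t \<ge> 0 \<Longrightarrow> g i t \<in> filippov switching (c t $ i, v t $ i, r t $ i)"
      "\<And>i t. - max_travel_time T \<le> t \<Longrightarrow> t < 0 \<Longrightarrow> g i t = switching (c t $ i, v t $ i, r t $ i)"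
      "AE t in lebesgue. t \<ge> 0 \<longrightarrow> (\<forall>i.
         ((\<lambda>s. c s $ i) has_real_derivative c_rate lam mu g i t) (at t within {0..}) \<and>
         ((\<lambda>s. v s $ i) has_real_derivative v_rate lam mu p T \<alpha> g i t) (at t within {0..}) \<and>
         ((\<lambda>s. r s $ i) has_real_derivative r_rate T \<alpha> \<beta> g i t) (at t within {0..}))"
      using ev unfolding evolution_def by force
    obtain N where N: "negligible N" "\<And>t. t \<notin> N \<Longrightarrow> t \<ge> 0 \<longrightarrow> (\<forall>i.
         ((\<lambda>s. c s $ i) has_real_derivative c_rate lam mu g i t) (at t within {0..}) \<and>
         ((\<lambda>s. v s $ i) has_real_derivative v_rate lam mu p T \<alpha> g i t) (at t within {0..}) \<and>
         ((\<lambda>s. r s $ i) has_real_derivative r_rate T \<alpha> \<beta> g i t) (at t within {0..}))"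
      using AE_lebesgue_obtains_negligible[OF g(3)] by blast
    interpret perturbed_equilibrium lam mu p T \<alpha> \<beta> c v r g N
    proof
      show "g i t = (1, 0, 1)" if "- max_travel_time T \<le> t" "t < 0" for i t
        using g(2)[OF that] past that switching_at_equilibrium[OF eq, of i] by auto
      show "v 0 $ i > c 0 $ i" for i
        using near(1,2)[of i] \<delta>(1)[of i] by linarith
      show "r 0 $ i > 0" for i
        using near(3)[of i] \<delta>(2)[of i] by linarith
    qed (use assms ev g(1) N nonneg in \<open>auto simp: evolution_def feasible_assignment_def\<close>)
    define v_lim where "v_lim = (\<chi> i. v 0 $ i - c 0 $ i + (\<Sum>j\<in>UNIV - {i}. p $ j $ i * c 0 $ j))"
    have "(c \<longlongrightarrow> 0) at_top" "(v \<longlongrightarrow> v_lim) at_top" "(r \<longlongrightarrow> r 0) at_top"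
      using eventually_constant by (auto intro!: tendsto_eventually elim: eventually_mono simp: v_lim_def)
    moreover have "(0, v_lim, r 0) \<in> equilibria lam p T V R \<alpha> \<beta>"
    proof -
      have "v_lim $ i > 0" for i
      proof -
        have "(\<Sum>j\<in>UNIV - {i}. p $ j $ i * c 0 $ j) \<ge> 0"
          using assms(3) c_init by (intro sum_nonneg mult_nonneg_nonneg) auto
        then show ?thesis using v_init[of i] by (simp add: v_lim_def)
      qed
      \<comment> \<open>Each vehicle taken by a queued customer reappears at some station: the rows
        of \<open>p\<close> sum to 1, and the zero diagonal lets \<open>j = i\<close> be
        included.\<close>
      moreover have "(\<Sum>i\<in>UNIV. v_lim $ i) = (\<Sum>i\<in>UNIV. v 0 $ i)"
      proof -
        have "(\<Sum>i\<in>UNIV. \<Sum>j\<in>UNIV - {i}. p $ j $ i * c 0 $ j) = (\<Sum>i\<in>UNIV. \<Sum>j\<in>UNIV. p $ j $ i * c 0 $ j)"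
          using assms(4) by (intro sum.cong refl sum.mono_neutral_left) auto
        also have "\<dots> = (\<Sum>j\<in>UNIV. (\<Sum>i\<in>UNIV. p $ j $ i) * c 0 $ j)"
          by (subst sum.swap) (simp add: sum_distrib_right)
        also have "\<dots> = (\<Sum>j\<in>UNIV. c 0 $ j)"
          using assms(5) by simp
        finally show ?thesis by (simp add: v_lim_def sum.distrib sum_subtractf)
      qed
      ultimately show ?thesis using sums r_init by (simp add: equilibria_def)
    qed
    ultimately show ?thesis by blast
  qed
  ultimately show "\<exists>\<delta>>0. \<forall>c v r.
      evolution lam mu p T \<alpha> \<beta> c v r \<and>
      (\<forall>\<tau>\<in>{- max_travel_time T..<0}. c \<tau> = c0 \<and> v \<tau> = v0 \<and> r \<tau> = r0) \<and>
      (c 0, v 0, r 0) \<in> initial_ball lam p T V R \<alpha> \<beta> \<delta> (c0, v0, r0)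
      \<longrightarrow> (\<exists>c_lim v_lim r_lim.
             (c \<longlongrightarrow> c_lim) at_top \<and> (v \<longlongrightarrow> v_lim) at_top \<and> (r \<longlongrightarrow> r_lim) at_top \<and>
             (c_lim, v_lim, r_lim) \<in> equilibria lam p T V R \<alpha> \<beta>)"
    by blast
qed

end
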